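(* Let $n\ge 1$ and let $\mathbf A$ be a real $n\times n$ SK-matrix. Then $\mathbf A$ is a $\tau^<$-matrix; that is, $l(\mathbf A)>0$ and $l(\mathbf A(\alpha))<l(\mathbf A(\beta))<\infty$ whenever $\emptyset\neq\beta\subsetneq\alpha\subseteq[n]$.
   Context: Let $[n]=\{1,\ldots,n\}$. A principal minor of an $n\times n$ matrix $\mathbf A$ is the determinant of a submatrix whose rows and columns are both indexed by the same nonempty subset of $[n]$. An almost principal minor of $\mathbf A$ is a minor whose row set is $\{i_1,\ldots,i_k\}\setminus\{i_r\}$ and whose column set is $\{i_1,\ldots,i_k\}\setminus\{i_s\}$, where $\{i_1<\cdots<i_k\}\subseteq[n]$, $k\ge2$, $1\le r,s\le k$ and $r\ne s$ (rows and columns are listed in increasing order). A real square matrix is an SK-matrix (strictly Kotelyansky matrix) if all its principal minors and all its almost principal minors are positive. For a square matrix $\mathbf M$ with spectrum $\sigma(\mathbf M)$, $l(\mathbf M):=\min(\sigma(\mathbf M)\cap\mathbb R)$, with $l(\mathbf M):=\infty$ if $\mathbf M$ has no real eigenvalue. For nonempty $\alpha\subseteq[n]$, $\mathbf A(\alpha)$ is the principal submatrix of $\mathbf A$ with rows and columns indexed by $\alpha$. $\mathbf A$ is a $\tau$-matrix if $l(\mathbf A)\ge0$ and $l(\mathbf A(\alpha))\le l(\mathbf A(\beta))<\infty$ whenever $\emptyset\ne\beta\subseteq\alpha\subseteq[n]$. It is a $\tau^<$-matrix (strictly $\tau$-matrix) if, in addition, $l(\mathbf A)>0$ and $l(\mathbf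 A(\alpha))<l(\mathbf A(\beta))$ whenever $\emptyset\ne\beta\subsetneq\alpha\subseteq[n]$. *)

theory Defs
  imports
    "Jordan_Normal_Form.Spectral_Radius"
    "Jordan_Normal_Form.DL_Submatrix"
    "HOL-Library.Extended_Real"
begin

(* Matrices are indexed from 0, so the index set [n] is rendered as {..<n}.
   submatrix A I J lists the selected rows and columns in increasing order. *)

definition principal_minors_pos :: "real mat \<Rightarrow> bool" where
  "principal_minors_pos A \<longleftrightarrow>
     (\<forall>\<alpha>. \<alpha> \<noteq> {} \<and> \<alpha> \<subseteq> {..<dim_row A} \<longrightarrow> det (submatrix A \<alpha> \<alpha>) > 0)"

(* Having two distinct elements r, s forces \<alpha> to have at least two elements. *)
definition almost_principal_minors_pos :: "real mat \<Rightarrow> bool" where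
  "almost_principal_minors_pos A \<longleftrightarrow>
     (\<forall>\<alpha> r s. \<alpha> \<subseteq> {..<dim_row A} \<and> r \<in> \<alpha> \<and> s \<in> \<alpha> \<and> r \<noteq> s
        \<longrightarrow> det (submatrix A (\<alpha> - {r}) (\<alpha> - {s})) > 0)"

definition SK_matrix :: "real mat \<Rightarrow> bool" where
  "SK_matrix A \<longleftrightarrow> square_mat A \<and> principal_minors_pos A \<and> almost_principal_minors_pos A"

definition principal_submatrix :: "'a mat \<Rightarrow> nat set \<Rightarrow> 'a mat" where
  "principal_submatrix A \<alpha> = submatrix A \<alpha> \<alpha>"

(* The quantity l(M), for square M. The spectrum is the complex one, so real matrices
   are embedded into the complex ones before this notion is applied. The spectrum of a
   square matrix is finite, so Min is the true minimum. *)
definition min_real_eigenvalue :: "complex mat \<Rightarrow> ereal" where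
  "min_real_eigenvalue M =
     (if spectrum M \<inter> \<real> = {} then \<infinity> else ereal (Min (Re ` (spectrum M \<inter> \<real>))))"

definition tau_matrix :: "complex mat \<Rightarrow> bool" where
  "tau_matrix A \<longleftrightarrow>
     square_mat A \<and>
     min_real_eigenvalue A \<ge> 0 \<and>
     (\<forall>\<alpha> \<beta>. \<beta> \<noteq> {} \<and> \<beta> \<subseteq> \<alpha> \<and> \<alpha> \<subseteq> {..<dim_row A} \<longrightarrow>
        min_real_eigenvalue (principal_submatrix A \<alpha>)
          \<le> min_real_eigenvalue (principal_submatrix A \<beta>) \<and>
        min_real_eigenvalue (principal_submatrix A \<beta>) < \<infinity>)"

definition strict_tau_matrix :: "complex mat \<Rightarrow> bool" where
  "strict_tau_matrix A \<longleftrightarrow>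
     tau_matrix A \<and>
     min_real_eigenvalue A > 0 \<and>
     (\<forall>\<alpha> \<beta>. \<beta> \<noteq> {} \<and> \<beta> \<subset> \<alpha> \<and> \<alpha> \<subseteq> {..<dim_row A} \<longrightarrow>
        min_real_eigenvalue (principal_submatrix A \<alpha>)
          < min_real_eigenvalue (principal_submatrix A \<beta>))"

end

theory Submission
  imports Defs
begin

text \<open>Let \<open>S = diag (1, -1, 1, \<dots>)\<close>. For every principal submatrix \<open>M\<close> of an SK-matrix,
  positivity of the minors of order one less makes \<open>B = S M\<^sup>-\<^sup>1 S\<close> entrywise positive, so by Perron
  there are \<open>\<rho> > 0\<close> and \<open>x > 0\<close> with \<open>B x = \<rho> x\<close>, and \<open>1 / \<rho>\<close> is an eigenvalue of \<open>M\<close>.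

  If deleting row and column \<open>k\<close> leaves a matrix with an eigenvalue \<open>t \<ge> 0\<close>, extend the eigenvector by
  zero at \<open>k\<close>: the result \<open>z\<close> satisfies \<open>M z = t z + c e\<^sub>k\<close>, and \<open>w = S z\<close> satisfies
  \<open>w = t B w \<plusminus> c B e\<^sub>k\<close> with \<open>w\<^sub>k = 0\<close>. For \<open>t \<le> 1 / \<rho>\<close> the maximum principle makes \<open>w\<close> of one sign,
  and then the \<open>k\<close>-th coordinate of this equation forces \<open>w = 0\<close>. So \<open>1 / \<rho> < t\<close>. Real eigenvalues are
  positive because all principal minors are: \<open>det (M + s)\<close> increases in \<open>s \<ge> 0\<close>, its derivative
  being the sum of the same quantities for the principal submatrices of order one less.\<close>

section \<open>Monotonicity of matrix-vector products and powers of nonnegative matrices\<close>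

lemma index_mult_mat_vec_sum:
  assumes "A \<in> carrier_mat m n" "v \<in> carrier_vec n" "i < m"
  shows "(A *\<^sub>v v) $ i = (\<Sum>j<n. A $$ (i,j) * v $ j)"
  using assms by (auto simp: scalar_prod_def atLeast0LessThan intro!: sum.cong)

lemma mult_mat_vec_mono:
  fixes A :: "real mat"
  assumes "A \<in> carrier_mat m n" "v \<in> carrier_vec n" "w \<in> carrier_vec n"
    and "\<And>i j. i < m \<Longrightarrow> j < n \<Longrightarrow> A $$ (i,j) \<ge> 0"
    and "\<And>j. j < n \<Longrightarrow> v $ j \<le> w $ j" "i < m"
  shows "(A *\<^sub>v v) $ i \<le> (A *\<^sub>v w) $ i"
  using assms by (simp add: index_mult_mat_vec_sum[OF assms(1)] del: index_mult_mat_vec)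
    (auto intro!: sum_mono mult_left_mono)

lemma mult_mat_vec_strict_mono:
  fixes A :: "real mat"
  assumes "A \<in> carrier_mat m n" "v \<in> carrier_vec n" "w \<in> carrier_vec n"
    and "\<And>i j. i < m \<Longrightarrow> j < n \<Longrightarrow> A $$ (i,j) > 0"
    and "\<And>j. j < n \<Longrightarrow> v $ j \<le> w $ j" "k < n" "v $ k < w $ k" "i < m"
  shows "(A *\<^sub>v v) $ i < (A *\<^sub>v w) $ i"
proof -
  have "(\<Sum>j<n. A $$ (i,j) * v $ j) < (\<Sum>j<n. A $$ (i,j) * w $ j)"
    using assms by (intro sum_strict_mono_ex1) (auto intro!: mult_left_mono less_imp_le)
  then show ?thesis
    using assms by (simp add: index_mult_mat_vec_sum[OF assms(1)] del: index_mult_mat_vec)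
qed

lemma pow_mat_nonneg:
  fixes A :: "real mat"
  assumes A: "A \<in> carrier_mat n n" and nonneg: "\<And>i j. i < n \<Longrightarrow> j < n \<Longrightarrow> A $$ (i,j) \<ge> 0"
    and "i < n" "j < n"
  shows "(A ^\<^sub>m k) $$ (i,j) \<ge> 0"
  using \<open>i < n\<close> \<open>j < n\<close>
proof (induction k arbitrary: i j)
  case 0
  then show ?case using A by (auto simp: one_mat_def)
next
  case (Suc k)
  have "(A ^\<^sub>m Suc k) $$ (i,j) = (\<Sum>l<n. (A ^\<^sub>m k) $$ (i,l) * A $$ (l,j))"
    using A pow_carrier_mat[OF A, of k] Suc.prems
    by (auto simp: scalar_prod_def atLeast0LessThan intro!: sum.cong)
  then show ?case using Suc nonneg by (auto intro!: sum_nonneg)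
qed

section \<open>Perron's theorem for positive matrices\<close>

text \<open>Multiplication by \<open>s\<close> carries eigenvalues of \<open>A / s\<close> to
  eigenvalues of \<open>A\<close>. A radius below 1 is what makes all powers of the rescaled matrix
  uniformly bounded.\<close>

lemma spectral_radius_smult_less_1:
  fixes A :: "complex mat" and s :: real
  assumes A: "A \<in> carrier_mat n n" and n: "n > 0" and s: "spectral_radius A < s" "s > 0"
  shows "spectral_radius (complex_of_real (1 / s) \<cdot>\<^sub>m A) < 1"
proof -
  let ?C = "complex_of_real (1 / s) \<cdot>\<^sub>m A"
  have C: "?C \<in> carrier_mat n n" using A by auto
  obtain m where m: "m \<in> spectrum ?C" "norm m = spectral_radius ?C"
    using spectral_radius_mem_max(1)[OF C n] by (metis imageE)
  then obtain v where v: "v \<in> carrier_vec n" "v \<noteq> 0\<^sub>v n" "?C *\<^sub>v v = m \<cdot>\<^sub>v v"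
    using C unfolding spectrum_def eigenvalue_def eigenvector_def by auto
  have "A *\<^sub>v v = complex_of_real s \<cdot>\<^sub>v (?C *\<^sub>v v)"
    using A v(1) s(2) by (intro eq_vecI) auto
  also have "\<dots> = (complex_of_real s * m) \<cdot>\<^sub>v v"
    unfolding v(3) using v(1) by (simp add: smult_smult_assoc)
  finally have "complex_of_real s * m \<in> spectrum A"
    using A v unfolding spectrum_def eigenvalue_def eigenvector_def by auto
  then have "norm (complex_of_real s * m) \<le> spectral_radius A"
    using spectral_radius_mem_max(2)[OF A n] by blast
  then have "s * spectral_radius ?C \<le> spectral_radius A"
    using m(2) s(2) by (simp add: norm_mult)
  then have "s * spectral_radius ?C < s * 1"
    using s(1) by linarith
  then show ?thesis using s(2) mult_less_cancel_left_pos by blast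
qed

lemma spectral_radius_nonneg:
  fixes A :: "complex mat"
  assumes A: "A \<in> carrier_mat n n" and n: "n > 0"
  shows "spectral_radius A \<ge> 0"
  using spectral_radius_mem_max(1)[OF assms] by auto

text \<open>Were \<open>r\<close> above the spectral radius, a rescaling of \<open>A\<close> would
  have bounded powers and yet stretch the positive vector \<open>w\<close> by a fixed factor above 1
  at every application.\<close>

lemma Collatz_Wielandt_le_spectral_radius:
  fixes A :: "real mat"
  assumes A: "A \<in> carrier_mat n n" and n: "n > 0"
    and nonneg: "\<And>i j. i < n \<Longrightarrow> j < n \<Longrightarrow> A $$ (i,j) \<ge> 0"
    and w: "w \<in> carrier_vec n" and wpos: "\<And>i. i < n \<Longrightarrow> w $ i > 0"
    and r: "\<And>i. i < n \<Longrightarrow> (A *\<^sub>v w) $ i \<ge> r * w $ i"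
  shows "r \<le> spectral_radius (map_mat complex_of_real A)"
proof (rule ccontr)
  let ?A = "map_mat complex_of_real A"
  define \<rho> where "\<rho> = spectral_radius ?A"
  assume "\<not> ?thesis"
  then have r\<rho>: "\<rho> < r" by (simp add: \<rho>_def)
  have cA: "?A \<in> carrier_mat n n" using A by auto
  have \<rho>0: "\<rho> \<ge> 0" unfolding \<rho>_def by (rule spectral_radius_nonneg[OF cA n])
  \<comment> \<open>With \<open>s\<close> strictly between \<open>\<rho>\<close> and
    \<open>r\<close>, \<open>A / s\<close> has spectral radius below 1 but still expands
    \<open>w\<close> by \<open>q > 1\<close>. The midpoint is positive even when
    \<open>\<rho> = 0\<close>.\<close>
  define s q where "s = (\<rho> + r) / 2" and "q = r / s"
  have s: "\<rho> < s" "0 < s" and q: "1 < q"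
    using r\<rho> \<rho>0 by (auto simp: s_def q_def field_simps)
  define C where "C = (1 / s) \<cdot>\<^sub>m A"
  have C: "C \<in> carrier_mat n n" using A by (simp add: C_def)
  have Cnonneg: "C $$ (i,j) \<ge> 0" if "i < n" "j < n" for i j
    using that A nonneg s by (simp add: C_def)
  have Ccplx: "map_mat complex_of_real C = complex_of_real (1 / s) \<cdot>\<^sub>m ?A"
    by (auto simp: C_def)
  have cC: "map_mat complex_of_real C \<in> carrier_mat n n" using C by auto
  have "spectral_radius (map_mat complex_of_real C) < 1"
    unfolding Ccplx by (rule spectral_radius_smult_less_1[OF cA n]) (use s in \<open>auto simp: \<rho>_def\<close>)
  from spectral_radius_jnf_norm_bound_less_1_upper_triangular[OF cC this]
  obtain c where c: "\<And>k. norm_bound (map_mat complex_of_real C ^\<^sub>m k) c" by auto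
  have Ck: "C ^\<^sub>m k \<in> carrier_mat n n" for k using C by simp
  have bound: "(C ^\<^sub>m k) $$ (i,j) \<le> c" if "i < n" "j < n" for i j k
  proof -
    have "norm ((map_mat complex_of_real C ^\<^sub>m k) $$ (i,j)) \<le> c"
      using c[of k] that C unfolding norm_bound_def by (auto simp: pow_mat_dim_square)
    moreover have "(map_mat complex_of_real C ^\<^sub>m k) $$ (i,j) = complex_of_real ((C ^\<^sub>m k) $$ (i,j))"
      using that carrier_matD[OF Ck[of k]] by (simp add: of_real_hom.mat_hom_pow[OF C, symmetric])
    ultimately show ?thesis by simp
  qed
  have Cw: "q * w $ i \<le> (C *\<^sub>v w) $ i" if "i < n" for i
  proof -
    have "q * w $ i = (1 / s) * (r * w $ i)" by (simp add: q_def)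
    also have "\<dots> \<le> (1 / s) * (A *\<^sub>v w) $ i"
      using r[OF that] s by (intro mult_left_mono) auto
    also have "\<dots> = (C *\<^sub>v w) $ i"
      using that A w by (simp add: C_def)
    finally show ?thesis .
  qed
  \<comment> \<open>Powers of \<open>C\<close> are nonnegative, so they preserve the entrywise
    inequality \<open>q w \<le> C w\<close>; each further factor \<open>C\<close> contributes a
    factor \<open>q\<close>.\<close>
  have pow: "q ^ k * w $ i \<le> (C ^\<^sub>m k *\<^sub>v w) $ i" if "i < n" for i k
    using that
  proof (induction k)
    case 0
    then show ?case using C w by simp
  next
    case (Suc k)
    have "q ^ Suc k * w $ i \<le> q * (C ^\<^sub>m k *\<^sub>v w) $ i"
      using Suc q by simp
    also have "\<dots> = (C ^\<^sub>m k *\<^sub>v (q \<cdot>\<^sub>v w)) $ i"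
      using Suc.prems carrier_matD[OF Ck[of k]] mult_mat_vec[OF Ck w] by (simp del: index_mult_mat_vec)
    also have "\<dots> \<le> (C ^\<^sub>m k *\<^sub>v (C *\<^sub>v w)) $ i"
      using Suc.prems w C Cw
      by (intro mult_mat_vec_mono[OF Ck]) (auto intro: pow_mat_nonneg[OF C Cnonneg] simp del: index_mult_mat_vec)
    also have "C ^\<^sub>m k *\<^sub>v (C *\<^sub>v w) = C ^\<^sub>m Suc k *\<^sub>v w"
      using assoc_mult_mat_vec[OF Ck C w] by simp
    finally show ?case .
  qed
  \<comment> \<open>The bound does not depend on \<open>k\<close>, so the growth of
    \<open>q ^ k\<close> contradicts it; coordinate 0 exists because \<open>n > 0\<close>.\<close>
  have "q ^ k * w $ 0 \<le> (\<Sum>j<n. c * w $ j)" for k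
  proof -
    have "(C ^\<^sub>m k *\<^sub>v w) $ 0 = (\<Sum>j<n. (C ^\<^sub>m k) $$ (0,j) * w $ j)"
      by (rule index_mult_mat_vec_sum[OF Ck w n])
    also have "\<dots> \<le> (\<Sum>j<n. c * w $ j)"
      using bound n wpos by (intro sum_mono mult_right_mono) (auto intro: less_imp_le)
    finally show ?thesis using pow[OF n, of k] by simp
  qed
  moreover obtain k where "(\<Sum>j<n. c * w $ j) / w $ 0 < q ^ k"
    using real_arch_pow[OF q] by auto
  ultimately show False
    using wpos[OF n] by (simp add: field_simps not_less[symmetric])
qed

text \<open>If the vector of absolute values of a dominant eigenvector were not itself an eigenvector,
  applying \<open>A\<close> once more would push the Collatz-Wielandt bound above the spectral radius.\<close>

lemma Perron_positive_eigenvector: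
  fixes A :: "real mat"
  assumes A: "A \<in> carrier_mat n n" and n: "n > 0"
    and pos: "\<And>i j. i < n \<Longrightarrow> j < n \<Longrightarrow> A $$ (i,j) > 0"
  obtains \<rho> x where "\<rho> > 0" "x \<in> carrier_vec n" "\<And>i. i < n \<Longrightarrow> x $ i > 0" "A *\<^sub>v x = \<rho> \<cdot>\<^sub>v x"
proof -
  let ?A = "map_mat complex_of_real A"
  define \<rho> where "\<rho> = spectral_radius ?A"
  have cA: "?A \<in> carrier_mat n n" using A by auto
  have \<rho>0: "\<rho> \<ge> 0" unfolding \<rho>_def by (rule spectral_radius_nonneg[OF cA n])
  obtain ev where ev: "ev \<in> spectrum ?A" "norm ev = \<rho>"
    using spectral_radius_mem_max(1)[OF cA n] unfolding \<rho>_def by (metis imageE)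
  then obtain v where v: "v \<in> carrier_vec n" "v \<noteq> 0\<^sub>v n" "?A *\<^sub>v v = ev \<cdot>\<^sub>v v"
    using cA unfolding spectrum_def eigenvalue_def eigenvector_def by auto
  define u where "u = vec n (\<lambda>i. norm (v $ i))"
  define w where "w = A *\<^sub>v u"
  have u: "u \<in> carrier_vec n" and w: "w \<in> carrier_vec n" using A by (auto simp: u_def w_def)
  have u0: "u $ i \<ge> 0" if "i < n" for i using that by (simp add: u_def)
  obtain i0 where i0: "i0 < n" "u $ i0 > 0"
    using v(1,2) by (metis u_def carrier_vecD eq_vecI index_vec index_zero_vec zero_less_norm_iff)
  \<comment> \<open>Triangle inequality in each coordinate of \<open>A v = ev v\<close>, where
    \<open>ev\<close> has modulus \<open>\<rho>\<close> and the entries of \<open>A\<close> equal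
    their moduli.\<close>
  have le: "\<rho> * u $ i \<le> w $ i" if "i < n" for i
  proof -
    have "\<rho> * u $ i = norm ((?A *\<^sub>v v) $ i)"
      unfolding v(3) using that v(1) ev(2) by (simp add: u_def norm_mult)
    also have "\<dots> \<le> (\<Sum>j<n. norm (?A $$ (i,j) * v $ j))"
      unfolding index_mult_mat_vec_sum[OF cA v(1) that] by (rule norm_sum)
    also have "\<dots> = (\<Sum>j<n. A $$ (i,j) * u $ j)"
      using that A pos by (intro sum.cong) (auto simp: norm_mult u_def less_imp_le)
    also have "\<dots> = w $ i"
      unfolding w_def by (rule index_mult_mat_vec_sum[OF A u that, symmetric])
    finally show ?thesis .
  qed
  have w_pos: "w $ i > 0" if "i < n" for i
    using mult_mat_vec_strict_mono[OF A zero_carrier_vec u pos _ i0(1) _ that] u0 i0 that A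
    by (simp add: w_def)
  have "w = \<rho> \<cdot>\<^sub>v u"
  proof (rule ccontr)
    assume "w \<noteq> \<rho> \<cdot>\<^sub>v u"
    then obtain k where k: "k < n" "\<rho> * u $ k < w $ k"
      using le u w by (metis carrier_vecD eq_vecI index_smult_vec order_le_less)
    \<comment> \<open>\<open>\<rho> u \<le> w\<close> is strict at \<open>k\<close>, and a positive
      matrix spreads one strict coordinate to all of them.\<close>
    have gt: "\<rho> * w $ i < (A *\<^sub>v w) $ i" if "i < n" for i
    proof -
      have "\<rho> * w $ i = (A *\<^sub>v (\<rho> \<cdot>\<^sub>v u)) $ i"
        using that A u by (simp add: w_def mult_mat_vec)
      also have "\<dots> < (A *\<^sub>v w) $ i"
        using k le u that by (intro mult_mat_vec_strict_mono[OF A _ w pos]) auto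
      finally show ?thesis .
    qed
    \<comment> \<open>The largest \<open>r\<close> with \<open>r w \<le> A w\<close>. As a minimum
      of finitely many ratios above \<open>\<rho>\<close> it still exceeds
      \<open>\<rho>\<close>.\<close>
    define r where "r = Min ((\<lambda>i. (A *\<^sub>v w) $ i / w $ i) ` {..<n})"
    have "\<rho> < r"
      unfolding r_def using n gt w_pos by (subst Min_gr_iff) (auto simp: field_simps)
    moreover have "r * w $ i \<le> (A *\<^sub>v w) $ i" if "i < n" for i
    proof -
      have "r \<le> (A *\<^sub>v w) $ i / w $ i" unfolding r_def using that by (intro Min_le) auto
      then show ?thesis using w_pos[OF that] by (simp add: field_simps)
    qed
    then have "r \<le> \<rho>"
      unfolding \<rho>_def
      by (intro Collatz_Wielandt_le_spectral_radius[OF A n _ w w_pos]) (auto intro: less_imp_le pos)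
    ultimately show False by simp
  qed
  \<comment> \<open>Positivity of \<open>w = \<rho> u\<close> rules out both
    \<open>\<rho> = 0\<close> and zero entries of \<open>u\<close>.\<close>
  then have "\<rho> * u $ i > 0" if "i < n" for i
    using w_pos[OF that] that u by simp
  then have "\<rho> > 0" "\<And>i. i < n \<Longrightarrow> u $ i > 0"
    using \<rho>0 u0 n by (auto simp: zero_less_mult_iff)
  then show thesis using that u \<open>w = \<rho> \<cdot>\<^sub>v u\<close> by (simp add: w_def)
qed


section \<open>Submatrices and deletion of rows and columns\<close>

text \<open>\<open>pick S i\<close> is the element of \<open>S\<close> with exactly \<open>i\<close>
  smaller ones. Removing \<open>pick S a\<close> keeps this count for elements below it and lowers
  it by one for those above, which the shift in \<open>insert_index\<close> compensates.\<close>

lemma pick_Diff_singleton: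
  assumes S: "finite S" and a: "a < card S" and i: "i < card S - 1"
  shows "pick (S - {pick S a}) i = pick S (insert_index a i)"
proof -
  let ?y = "pick S (insert_index a i)"
  have less: "insert_index a i < card S" using i by (auto simp: insert_index_def)
  have y: "?y \<in> S" using pick_in_set_le[OF less] .
  have neq: "?y \<noteq> pick S a"
    using insert_index_exclude[of a i] less a by (metis nat_neq_iff pick_mono_le)
  have "card {x \<in> S - {pick S a}. x < ?y} = i"
  proof (cases "i < a")
    case True
    then have "?y < pick S a" using pick_mono_le[OF a] by simp
    then have "{x \<in> S - {pick S a}. x < ?y} = {x \<in> S. x < ?y}" by auto
    then show ?thesis using card_pick_le[OF less] True by simp
  next
    case False
    then have "pick S a < ?y" using pick_mono_le[OF less, of a] by simp
    moreover have "{x \<in> S - {pick S a}. x < ?y} = {x \<in> S. x < ?y} - {pick S a}" by auto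
    ultimately show ?thesis
      using card_pick_le[OF less] False pick_in_set_le[OF a] S by simp
  qed
  then show ?thesis using pick_card_in_set[of ?y "S - {pick S a}"] y neq by simp
qed

lemma submatrix_carrier:
  assumes "A \<in> carrier_mat m n" "I \<subseteq> {..<m}" "J \<subseteq> {..<n}"
  shows "submatrix A I J \<in> carrier_mat (card I) (card J)"
proof -
  have "{i. i < m \<and> i \<in> I} = I" "{j. j < n \<and> j \<in> J} = J" using assms by auto
  then show ?thesis using assms by (auto simp: dim_submatrix)
qed

lemma submatrix_nth:
  assumes "A \<in> carrier_mat m n" "I \<subseteq> {..<m}" "J \<subseteq> {..<n}" "i < card I" "j < card J"
  shows "submatrix A I J $$ (i,j) = A $$ (pick I i, pick J j)"
proof -
  have "{i. i < m \<and> i \<in> I} = I" "{j. j < n \<and> j \<in> J} = J" using assms by auto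
  then show ?thesis using assms by (intro submatrix_index) auto
qed

text \<open>Bridge between minors given by index sets, as in the definition of SK-matrices, and
  minors given by deleted positions, as in cofactors and in the derivative of the characteristic
  polynomial.\<close>

lemma mat_delete_submatrix:
  assumes A: "A \<in> carrier_mat m n" and I: "I \<subseteq> {..<m}" and J: "J \<subseteq> {..<n}"
    and a: "a < card I" and b: "b < card J"
  shows "mat_delete (submatrix A I J) a b = submatrix A (I - {pick I a}) (J - {pick J b})"
proof -
  have fin: "finite I" "finite J" using I J finite_subset by blast+
  have mem: "pick I a \<in> I" "pick J b \<in> J" using a b by (auto intro: pick_in_set_le)
  have sub: "submatrix A (I - {pick I a}) (J - {pick J b}) \<in> carrier_mat (card I - 1) (card J - 1)"
    using submatrix_carrier[OF A, of "I - {pick I a}" "J - {pick J b}"] I J mem fin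
    by (auto simp: card_Diff_singleton)
  have del: "mat_delete (submatrix A I J) a b \<in> carrier_mat (card I - 1) (card J - 1)"
    using submatrix_carrier[OF A I J] by (auto simp: mat_delete_def)
  show ?thesis
  proof (rule eq_matI)
    fix i j
    assume "i < dim_row (submatrix A (I - {pick I a}) (J - {pick J b}))"
      "j < dim_col (submatrix A (I - {pick I a}) (J - {pick J b}))"
    then have ij: "i < card I - 1" "j < card J - 1" using sub by auto
    then have less: "insert_index a i < card I" "insert_index b j < card J"
      by (auto simp: insert_index_def)
    have "mat_delete (submatrix A I J) a b $$ (i,j)
        = submatrix A I J $$ (insert_index a i, insert_index b j)"
      using ij submatrix_carrier[OF A I J] by (auto simp: mat_delete_def insert_index_def)
    also have "\<dots> = A $$ (pick I (insert_index a i), pick J (insert_index b j))"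
      by (rule submatrix_nth[OF A I J less])
    also have "\<dots> = A $$ (pick (I - {pick I a}) i, pick (J - {pick J b}) j)"
      using pick_Diff_singleton[OF fin(1) a ij(1)] pick_Diff_singleton[OF fin(2) b ij(2)] by simp
    also have "\<dots> = submatrix A (I - {pick I a}) (J - {pick J b}) $$ (i,j)"
      using I J ij mem fin by (intro submatrix_nth[OF A, symmetric]) (auto simp: card_Diff_singleton)
    finally show "mat_delete (submatrix A I J) a b $$ (i,j)
        = submatrix A (I - {pick I a}) (J - {pick J b}) $$ (i,j)" .
  qed (use sub del in auto)
qed

lemma pick_lessThan:
  assumes "i < n"
  shows "pick {..<n} i = i"
proof -
  have "{a \<in> {..<n}. a < i} = {..<i}" using assms by auto
  then show ?thesis using pick_card_in_set[of i "{..<n}"] assms by simp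
qed

lemma submatrix_lessThan:
  assumes "A \<in> carrier_mat m n"
  shows "submatrix A {..<m} {..<n} = A"
  using assms submatrix_carrier[OF assms order_refl order_refl]
  by (intro eq_matI) (auto simp: submatrix_nth[OF assms order_refl order_refl] pick_lessThan)

lemma map_mat_submatrix:
  assumes A: "A \<in> carrier_mat m n" and I: "I \<subseteq> {..<m}" and J: "J \<subseteq> {..<n}"
  shows "submatrix (map_mat f A) I J = map_mat f (submatrix A I J)"
proof (rule eq_matI)
  have fA: "map_mat f A \<in> carrier_mat m n" using A by auto
  note carrier = submatrix_carrier[OF A I J] submatrix_carrier[OF fA I J]
  show "dim_row (submatrix (map_mat f A) I J) = dim_row (map_mat f (submatrix A I J))"
    "dim_col (submatrix (map_mat f A) I J) = dim_col (map_mat f (submatrix A I J))"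
    using carrier by auto
  fix i j
  assume "i < dim_row (map_mat f (submatrix A I J))" "j < dim_col (map_mat f (submatrix A I J))"
  then have ij: "i < card I" "j < card J" using carrier by auto
  have "pick I i \<in> I" "pick J j \<in> J" using ij by (auto intro: pick_in_set_le)
  then have "pick I i < dim_row A" "pick J j < dim_col A" using A I J by auto
  then show "submatrix (map_mat f A) I J $$ (i,j) = map_mat f (submatrix A I J) $$ (i,j)"
    using ij carrier by (simp add: submatrix_nth[OF A I J] submatrix_nth[OF fA I J])
qed

section \<open>Positivity of real eigenvalues\<close>

text \<open>The signed value is \<open>det (M + s I)\<close> for the principal submatrix
  \<open>M\<close>, written through the characteristic polynomial to make its derivative available.
  Induction on the order starts from the empty index set, where the value is 1.\<close>

lemma minus_one_power_char_poly_pos: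
  fixes A :: "real mat"
  assumes A: "A \<in> carrier_mat n n"
    and minors: "\<And>\<alpha>. \<alpha> \<noteq> {} \<Longrightarrow> \<alpha> \<subseteq> {..<n} \<Longrightarrow> det (submatrix A \<alpha> \<alpha>) > 0"
    and "\<alpha> \<subseteq> {..<n}" "s \<ge> 0"
  shows "(-1) ^ card \<alpha> * poly (char_poly (submatrix A \<alpha> \<alpha>)) (- s) > 0"
  using \<open>\<alpha> \<subseteq> {..<n}\<close> \<open>s \<ge> 0\<close>
proof (induction "card \<alpha>" arbitrary: \<alpha> s)
  case 0
  then have "\<alpha> = {}" using finite_subset by fastforce
  moreover have "submatrix A {} {} \<in> carrier_mat 0 0" using submatrix_carrier[OF A, of "{}" "{}"] by simp
  then have "char_poly (submatrix A {} {}) = 1"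
    unfolding char_poly_def by (intro det_dim_zero) simp
  ultimately show ?case by simp
next
  case (Suc m)
  let ?M = "submatrix A \<alpha> \<alpha>"
  let ?q = "\<lambda>s. (-1) ^ card \<alpha> * poly (char_poly ?M) (- s)"
  have M: "?M \<in> carrier_mat (card \<alpha>) (card \<alpha>)" by (rule submatrix_carrier[OF A Suc.prems(1) Suc.prems(1)])
  have fin: "finite \<alpha>" using Suc.prems(1) finite_subset by blast
  have "?q 0 > 0"
  proof -
    have "- char_matrix ?M 0 = (- 1) \<cdot>\<^sub>m ?M"
      using M by (auto simp: char_matrix_def)
    then have "poly (char_poly ?M) 0 = (- 1) ^ card \<alpha> * det ?M"
      using M char_poly_matrix[OF M] by simp
    moreover have "\<alpha> \<noteq> {}" using Suc(2) by auto
    ultimately show ?thesis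
      using minors[OF _ Suc.prems(1)] by (simp flip: power_add mult.assoc)
  qed
  moreover have "?q 0 \<le> ?q s"
  proof (rule DERIV_nonneg_imp_nondecreasing[OF Suc.prems(2)])
    fix x :: real
    assume x: "0 \<le> x" "x \<le> s"
    let ?d = "(-1) ^ card \<alpha> * (poly (pderiv (char_poly ?M)) (- x) * - 1)"
    have "(?q has_real_derivative ?d) (at x)"
      by (auto intro!: derivative_eq_intros DERIV_chain2[OF poly_DERIV])
    \<comment> \<open>The factor \<open>- 1\<close> from differentiating \<open>- x\<close> cancels
      one sign; the remaining exponent \<open>m\<close> is the order of each matrix with one index
      deleted.\<close>
    moreover have "?d = (\<Sum>i<card \<alpha>. (-1) ^ m * poly (char_poly (mat_delete ?M i i)) (- x))"
      unfolding pderiv_char_poly[OF M] poly_sum sum_distrib_left sum_distrib_right Suc(2)[symmetric] power_Suc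
      by (intro sum.cong) simp_all
    moreover have "\<dots> \<ge> 0"
    proof (rule sum_nonneg)
      fix i assume "i \<in> {..<card \<alpha>}"
      then have i: "i < card \<alpha>" by simp
      have "pick \<alpha> i \<in> \<alpha>" using i by (rule pick_in_set_le)
      then have card: "card (\<alpha> - {pick \<alpha> i}) = m" using Suc(2) fin by simp
      have "(-1) ^ card (\<alpha> - {pick \<alpha> i})
          * poly (char_poly (submatrix A (\<alpha> - {pick \<alpha> i}) (\<alpha> - {pick \<alpha> i}))) (- x) > 0"
        using Suc.prems(1) x by (intro Suc.hyps(1)) (auto simp: card)
      then show "0 \<le> (-1) ^ m * poly (char_poly (mat_delete ?M i i)) (- x)"
        unfolding mat_delete_submatrix[OF A Suc.prems(1) Suc.prems(1) i i] card by simp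
    qed
    ultimately show "\<exists>y. (?q has_real_derivative y) (at x) \<and> 0 \<le> y" by metis
  qed
  ultimately show ?case by linarith
qed


lemma eigenvalue_submatrix_pos:
  fixes A :: "real mat"
  assumes A: "A \<in> carrier_mat n n"
    and minors: "\<And>\<alpha>. \<alpha> \<noteq> {} \<Longrightarrow> \<alpha> \<subseteq> {..<n} \<Longrightarrow> det (submatrix A \<alpha> \<alpha>) > 0"
    and \<alpha>: "\<alpha> \<subseteq> {..<n}" and ev: "eigenvalue (submatrix A \<alpha> \<alpha>) t"
  shows "t > 0"
proof (rule ccontr)
  assume "\<not> t > 0"
  then have "(-1) ^ card \<alpha> * poly (char_poly (submatrix A \<alpha> \<alpha>)) t > 0"
    using minus_one_power_char_poly_pos[OF A minors \<alpha>, of "- t"] by simp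
  then show False
    using ev eigenvalue_root_char_poly[OF submatrix_carrier[OF A \<alpha> \<alpha>]] by simp
qed

section \<open>Signed inverse and maximum principle\<close>

definition sign_mat :: "nat \<Rightarrow> 'a :: comm_ring_1 mat" where
  "sign_mat n = mat_diag n (\<lambda>i. (-1) ^ i)"

lemma sign_mat_carrier [simp]: "sign_mat n \<in> carrier_mat n n"
  by (simp add: sign_mat_def)

lemma sign_mat_square [simp]: "sign_mat n * sign_mat n = 1\<^sub>m n"
  by (simp add: sign_mat_def flip: power_add mult_2)

lemma sign_mat_mult_vec:
  assumes "v \<in> carrier_vec n" "i < n"
  shows "(sign_mat n *\<^sub>v v) $ i = (-1) ^ i * v $ i"
proof -
  have "(sign_mat n *\<^sub>v v) $ i = (\<Sum>j<n. if i = j then (-1) ^ j * v $ j else 0)"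
    unfolding index_mult_mat_vec_sum[OF sign_mat_carrier assms]
    using assms by (intro sum.cong) (auto simp: sign_mat_def mat_diag_def)
  then show ?thesis using assms(2) by simp
qed

text \<open>\<open>S A\<^sup>-\<^sup>1 S\<close> with \<open>S = sign_mat n\<close>.\<close>

definition signed_inverse :: "real mat \<Rightarrow> real mat" where
  "signed_inverse A = mat (dim_row A) (dim_row A) (\<lambda>(i,j). det (mat_delete A j i) / det A)"

lemma signed_inverse_carrier [simp]:
  "A \<in> carrier_mat n n \<Longrightarrow> signed_inverse A \<in> carrier_mat n n"
  by (auto simp: signed_inverse_def)

text \<open>Conjugation by \<open>sign_mat n\<close> multiplies entry \<open>(i,j)\<close> by
  \<open>(-1) ^ (i + j)\<close>, which cancels the cofactor sign. Hence the entries are plain minors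
  over \<open>det A\<close>, and their positivity can be read off.\<close>

lemma signed_inverse_eq:
  assumes A: "A \<in> carrier_mat n n"
  shows "signed_inverse A = sign_mat n * (((1 / det A) \<cdot>\<^sub>m adj_mat A) * sign_mat n)"
proof -
  have adj: "(1 / det A) \<cdot>\<^sub>m adj_mat A \<in> carrier_mat n n" using adj_mat(1)[OF A] by simp
  have "(- 1) ^ i * ((- 1) ^ (j + i) * d * (- 1) ^ j) = d" for d :: real and i j :: nat
    by (cases "even i"; cases "even j") simp_all
  then show ?thesis
    using A unfolding sign_mat_def mat_diag_mult_right[OF adj]
    by (subst mat_diag_mult_left[of _ n n])
      (auto intro!: eq_matI simp: signed_inverse_def adj_mat_def cofactor_def)
qed

text \<open>With \<open>S = sign_mat n\<close> and \<open>B = signed_inverse A\<close>,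
  \<open>S S = 1\<close> gives \<open>S B = A^-1 S\<close>. This form turns eigenvectors of
  \<open>B\<close> into eigenvectors of \<open>A\<close>.\<close>

lemma mult_sign_mat_signed_inverse:
  assumes A: "A \<in> carrier_mat n n" and d: "det A \<noteq> 0"
  shows "A * (sign_mat n * signed_inverse A) = sign_mat n"
proof -
  define Q where "Q = (1 / det A) \<cdot>\<^sub>m adj_mat A"
  have Q: "Q \<in> carrier_mat n n" using adj_mat(1)[OF A] by (simp add: Q_def)
  have "sign_mat n * signed_inverse A = Q * sign_mat n"
    unfolding signed_inverse_eq[OF A] Q_def[symmetric]
    using Q by (simp add: mult_carrier_mat[of _ n n _ n] flip: assoc_mult_mat[of _ n n _ n _ n])
  moreover have "A * Q = 1\<^sub>m n"
    unfolding Q_def using adj_mat(1,2)[OF A] A d by (simp add: mult_smult_distrib[OF A adj_mat(1)[OF A]])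
      (auto intro!: eq_matI)
  ultimately show ?thesis
    using A Q by (simp add: left_mult_one_mat[of _ n n] flip: assoc_mult_mat[of _ n n _ n _ n])
qed

text \<open>The left-handed counterpart, which turns an equation for \<open>A z\<close> into a
  fixed-point equation for \<open>S z\<close>.\<close>

lemma signed_inverse_mult_sign_mat:
  assumes A: "A \<in> carrier_mat n n" and d: "det A \<noteq> 0"
  shows "signed_inverse A * (sign_mat n * A) = sign_mat n"
proof -
  define Q where "Q = (1 / det A) \<cdot>\<^sub>m adj_mat A"
  have Q: "Q \<in> carrier_mat n n" using adj_mat(1)[OF A] by (simp add: Q_def)
  have "Q * A = 1\<^sub>m n"
    unfolding Q_def using adj_mat(1,3)[OF A] A d by (simp add: mult_smult_assoc_mat[OF adj_mat(1)[OF A] A])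
      (auto intro!: eq_matI)
  have "signed_inverse A * (sign_mat n * A) = sign_mat n * (Q * (sign_mat n * (sign_mat n * A)))"
    unfolding signed_inverse_eq[OF A] Q_def[symmetric] using A Q
    by (simp add: mult_carrier_mat[of _ n n _ n] assoc_mult_mat[of _ n n _ n _ n])
  also have "sign_mat n * (sign_mat n * A) = A"
    using A by (simp flip: assoc_mult_mat[of _ n n _ n _ n])
  also have "Q * A = 1\<^sub>m n" by fact
  finally show ?thesis by (simp add: right_mult_one_mat[of _ n n])
qed

text \<open>The maximum principle for \<open>1 - t B\<close>: compare \<open>w\<close> with the least multiple \<open>m x\<close> touching it
  from below.\<close>

lemma subinvariant_nonneg:
  fixes B :: "real mat"
  assumes B: "B \<in> carrier_mat n n" and n: "n > 0"
    and pos: "\<And>i j. i < n \<Longrightarrow> j < n \<Longrightarrow> B $$ (i,j) > 0"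
    and x: "x \<in> carrier_vec n" and xpos: "\<And>i. i < n \<Longrightarrow> x $ i > 0"
    and eig: "B *\<^sub>v x = \<rho> \<cdot>\<^sub>v x" and t: "0 \<le> t" "t * \<rho> \<le> 1"
    and w: "w \<in> carrier_vec n" and k: "k < n" "w $ k = 0"
    and sup: "\<And>i. i < n \<Longrightarrow> w $ i \<ge> t * (B *\<^sub>v w) $ i"
    and i: "i < n"
  shows "w $ i \<ge> 0"
proof -
  define m where "m = Min ((\<lambda>i. w $ i / x $ i) ` {..<n})"
  have "m \<in> (\<lambda>i. w $ i / x $ i) ` {..<n}" unfolding m_def using n by (intro Min_in) auto
  then obtain i0 where i0: "i0 < n" "w $ i0 = m * x $ i0" using xpos by force
  have ge: "m * x $ i \<le> w $ i" if "i < n" for i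
  proof -
    have "m \<le> w $ i / x $ i" unfolding m_def using that by (intro Min_le) auto
    then show ?thesis using xpos[OF that] by (simp add: field_simps)
  qed
  have "m \<ge> 0"
  proof (rule ccontr)
    assume "\<not> m \<ge> 0"
    then have m: "m < 0" by simp
    \<comment> \<open>The zero of \<open>w\<close> at \<open>k\<close> lies strictly above
      \<open>m x\<close>, so the positive matrix \<open>B\<close> makes the comparison strict at the
      touching index \<open>i0\<close> too.\<close>
    have "m * x $ k < w $ k" using k m xpos by (simp add: mult_neg_pos)
    then have "(B *\<^sub>v (m \<cdot>\<^sub>v x)) $ i0 < (B *\<^sub>v w) $ i0"
      using ge k(1) i0(1) x w by (intro mult_mat_vec_strict_mono[OF B _ w pos]) auto
    moreover have "(B *\<^sub>v (m \<cdot>\<^sub>v x)) $ i0 = m * \<rho> * x $ i0"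
      using i0(1) x mult_mat_vec[OF B x, of m] by (simp add: eig del: index_mult_mat_vec)
    ultimately have lt: "m * \<rho> * x $ i0 < (B *\<^sub>v w) $ i0" by simp
    \<comment> \<open>As \<open>m x\<close> is negative and \<open>t \<rho> \<le> 1\<close>, the
      factor \<open>t \<rho>\<close> can only raise it. Together with \<open>sup\<close> this
      clashes with \<open>lt\<close> unless \<open>t = 0\<close>, and then \<open>sup\<close> itself
      gives \<open>w \<ge> 0\<close> at \<open>i0\<close>.\<close>
    have "m * x $ i0 \<le> (t * \<rho>) * (m * x $ i0)"
      using mult_right_mono_neg[OF t(2), of "m * x $ i0"] m xpos[OF i0(1)]
      by (simp add: mult_neg_pos less_imp_le)
    then have "t * (B *\<^sub>v w) $ i0 \<le> t * (m * \<rho> * x $ i0)"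
      using sup[OF i0(1)] i0(2) by (simp add: ac_simps del: index_mult_mat_vec)
    then have "t = 0" using lt t(1) by (simp add: mult_le_cancel_left del: index_mult_mat_vec)
    then have "w $ i0 \<ge> 0" using sup[OF i0(1)] by simp
    then show False using i0(2) m xpos[OF i0(1)] by (simp add: zero_le_mult_iff)
  qed
  then have "0 \<le> m * x $ i" using xpos[OF i] by simp
  then show ?thesis using ge[OF i] by linarith
qed

text \<open>For \<open>c \<ge> 0\<close> the maximum principle gives \<open>w \<ge> 0\<close>. If
  \<open>w\<close> were nonzero, \<open>B w\<close> would be positive; then row \<open>k\<close>, a
  vanishing sum of nonnegative terms, forces \<open>t = 0\<close> and \<open>c = 0\<close>, and the
  equation returns \<open>w = 0\<close>.\<close>

lemma no_subcritical_bordered_solution: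
  fixes B :: "real mat"
  assumes B: "B \<in> carrier_mat n n"
    and pos: "\<And>i j. i < n \<Longrightarrow> j < n \<Longrightarrow> B $$ (i,j) > 0"
    and x: "x \<in> carrier_vec n" and xpos: "\<And>i. i < n \<Longrightarrow> x $ i > 0"
    and eig: "B *\<^sub>v x = \<rho> \<cdot>\<^sub>v x" and t: "0 \<le> t" "t * \<rho> \<le> 1"
    and w: "w \<in> carrier_vec n" and k: "k < n" "w $ k = 0"
    and eq: "\<And>i. i < n \<Longrightarrow> w $ i = t * (B *\<^sub>v w) $ i + c * B $$ (i,k)"
  shows "w = 0\<^sub>v n"
proof -
  have n: "n > 0" using k by simp
  have main: "v = 0\<^sub>v n"
    if v: "v \<in> carrier_vec n" "v $ k = 0" and "d \<ge> 0"
      and eq: "\<And>i. i < n \<Longrightarrow> v $ i = t * (B *\<^sub>v v) $ i + d * B $$ (i,k)" for v d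
  proof (rule ccontr)
    assume "v \<noteq> 0\<^sub>v n"
    have nonneg: "v $ i \<ge> 0" if "i < n" for i
    proof (rule subinvariant_nonneg[OF B n pos x xpos eig t v(1) k(1) v(2) _ that])
      fix i assume "i < n"
      then show "t * (B *\<^sub>v v) $ i \<le> v $ i"
        using eq[of i] pos[of i k] k(1) \<open>d \<ge> 0\<close> by (simp del: index_mult_mat_vec)
    qed
    obtain l where l: "l < n" "v $ l > 0"
      using \<open>v \<noteq> 0\<^sub>v n\<close> v(1) nonneg by (metis carrier_vecD eq_vecI index_zero_vec order_le_less)
    have Bv: "(B *\<^sub>v v) $ i > 0" if "i < n" for i
      using mult_mat_vec_strict_mono[OF B zero_carrier_vec v(1) pos _ l(1) _ that] l that nonneg B
      by simp
    have "t * (B *\<^sub>v v) $ k = 0" "d * B $$ (k,k) = 0"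
      using eq[OF k(1)] v(2) t(1) \<open>d \<ge> 0\<close> Bv[OF k(1)] pos[OF k(1) k(1)]
      by (simp_all add: add_nonneg_eq_0_iff del: index_mult_mat_vec)
    then have "t = 0" "d = 0"
      using Bv[OF k(1)] pos[OF k(1) k(1)] by (auto simp del: index_mult_mat_vec)
    then show False using eq[OF l(1)] l by simp
  qed
  show ?thesis
  proof (cases "c \<ge> 0")
    case True
    then show ?thesis using main[of w c] w k eq by blast
  next
    case False
    \<comment> \<open>The equation is invariant under changing the signs of \<open>w\<close> and
      \<open>c\<close> together.\<close>
    have "- w = 0\<^sub>v n"
    proof (rule main[of _ "- c"])
      fix i assume i: "i < n"
      have "(B *\<^sub>v (- w)) $ i = - (B *\<^sub>v w) $ i"
        using i B w by simp
      then show "(- w) $ i = t * (B *\<^sub>v (- w)) $ i + - c * B $$ (i,k)"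
        using i w eq[OF i] by (simp del: index_mult_mat_vec)
    qed (use w k False in auto)
    then show ?thesis using w by (metis uminus_uminus_vec uminus_zero_vec)
  qed
qed

section \<open>Eigenvalue comparison under deletion of one index\<close>

text \<open>Padding \<open>v\<close> with a zero at \<open>k\<close> keeps the eigenvalue equation
  in every other row, because column \<open>k\<close> meets the zero. The defect is confined to row
  \<open>k\<close>, and \<open>c\<close> is its size.\<close>

lemma eigenvector_mat_delete_extend:
  fixes A :: "'a :: comm_ring_1 mat"
  assumes A: "A \<in> carrier_mat n n" and k: "k < n"
    and v: "v \<in> carrier_vec (n - 1)" "mat_delete A k k *\<^sub>v v = t \<cdot>\<^sub>v v"
  obtains z c where "z \<in> carrier_vec n" "z $ k = 0"
    "\<And>i. i < n - 1 \<Longrightarrow> z $ insert_index k i = v $ i"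
    "A *\<^sub>v z = t \<cdot>\<^sub>v z + c \<cdot>\<^sub>v unit_vec n k"
proof -
  have D: "mat_delete A k k \<in> carrier_mat (n - 1) (n - 1)" using A by (auto simp: mat_delete_def)
  define z where "z = vec n (\<lambda>i. if i = k then 0 else v $ delete_index k i)"
  have z: "z \<in> carrier_vec n" "z $ k = 0" using k by (auto simp: z_def)
  have z_ins: "z $ insert_index k i = v $ i" if "i < n - 1" for i
  proof -
    have "insert_index k i < n" using that k by (auto simp: insert_index_def)
    then show ?thesis by (simp add: z_def)
  qed
  define c where "c = (A *\<^sub>v z) $ k"
  have Az: "A *\<^sub>v z = t \<cdot>\<^sub>v z + c \<cdot>\<^sub>v unit_vec n k"
  proof (rule eq_vecI)
    fix i assume "i < dim_vec (t \<cdot>\<^sub>v z + c \<cdot>\<^sub>v unit_vec n k)"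
    then have i: "i < n" by simp
    show "(A *\<^sub>v z) $ i = (t \<cdot>\<^sub>v z + c \<cdot>\<^sub>v unit_vec n k) $ i"
    proof (cases "i = k")
      case True
      then show ?thesis using i z k by (simp add: c_def)
    next
      case False
      define i' where "i' = delete_index k i"
      have ins: "insert_index k i' = i" using False by (simp add: i'_def insert_delete_index)
      have i': "i' < n - 1" using i k False by (auto simp: i'_def delete_index_def)
      have "(A *\<^sub>v z) $ i = (\<Sum>j\<in>{0..<Suc (n - 1)} - {k}. A $$ (i,j) * z $ j)"
        unfolding index_mult_mat_vec_sum[OF A z(1) i]
        using k z(2) by (intro sum.mono_neutral_right) auto
      also have "{0..<Suc (n - 1)} - {k} = insert_index k ` {0..<n - 1}"
        using k by (intro insert_index_image[symmetric]) simp
      also have "(\<Sum>j\<in>insert_index k ` {0..<n - 1}. A $$ (i,j) * z $ j)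
          = (\<Sum>j<n - 1. mat_delete A k k $$ (i',j) * v $ j)"
        unfolding sum.reindex[OF insert_index_inj_on] o_def
      proof (rule sum.cong)
        fix j assume "j \<in> {..<n - 1}"
        then have j: "j < n - 1" by simp
        have "A $$ (insert_index k i', insert_index k j) = mat_delete A k k $$ (i', j)"
          using mat_delete_index[of A "n - 1" k k i' j] A k i' j by simp
        then show "A $$ (i, insert_index k j) * z $ insert_index k j
            = mat_delete A k k $$ (i',j) * v $ j"
          using z_ins[OF j] ins by simp
      qed auto
      also have "\<dots> = (mat_delete A k k *\<^sub>v v) $ i'"
        by (rule index_mult_mat_vec_sum[OF D v(1) i', symmetric])
      also have "\<dots> = t * v $ i'" unfolding v(2) using i' v(1) by simp
      also have "\<dots> = (t \<cdot>\<^sub>v z + c \<cdot>\<^sub>v unit_vec n k) $ i"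
        using z_ins[OF i'] ins i z(1) False k by simp
      finally show ?thesis .
    qed
  qed (use A in auto)
  show thesis by (rule that[OF z z_ins Az])
qed

text \<open>One \<open>l\<close>, the reciprocal of the Perron eigenvalue of the signed inverse,
  serves all \<open>k\<close> at once. It is not claimed to be the least eigenvalue of
  \<open>A\<close>; any eigenvalue of \<open>A\<close> below all those \<open>t\<close> suffices
  later.\<close>

lemma eigenvalue_less_of_mat_delete:
  fixes A :: "real mat"
  assumes A: "A \<in> carrier_mat n n" and d: "det A > 0"
    and minors: "\<And>i j. i < n \<Longrightarrow> j < n \<Longrightarrow> det (mat_delete A i j) > 0"
    and n: "n > 0"
  obtains l where "eigenvalue A l"
    "\<And>k t. k < n \<Longrightarrow> t \<ge> 0 \<Longrightarrow> eigenvalue (mat_delete A k k) t \<Longrightarrow> l < t"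
proof -
  let ?B = "signed_inverse A" and ?S = "sign_mat n :: real mat"
  have B: "?B \<in> carrier_mat n n" using A by simp
  have pos: "?B $$ (i,j) > 0" if "i < n" "j < n" for i j
    using that A d minors by (auto simp: signed_inverse_def)
  obtain \<rho> x where \<rho>: "\<rho> > 0" and x: "x \<in> carrier_vec n" and xpos: "\<And>i. i < n \<Longrightarrow> x $ i > 0"
    and eig: "?B *\<^sub>v x = \<rho> \<cdot>\<^sub>v x"
    using Perron_positive_eigenvector[OF B n pos] by metis
  have Sx: "?S *\<^sub>v x \<in> carrier_vec n" using sign_mat_carrier x by (rule mult_mat_vec_carrier)
  have "?S *\<^sub>v x = (A * (?S * ?B)) *\<^sub>v x"
    using mult_sign_mat_signed_inverse[OF A] d by simp
  also have "\<dots> = A *\<^sub>v (?S *\<^sub>v (?B *\<^sub>v x))"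
    using A B x by (simp add: assoc_mult_mat_vec[of _ n n _ n] mult_carrier_mat[of _ n n _ n]
        mult_mat_vec_carrier[of _ n n])
  also have "\<dots> = \<rho> \<cdot>\<^sub>v (A *\<^sub>v (?S *\<^sub>v x))"
    unfolding eig using A Sx x by (simp add: mult_mat_vec[of _ n n])
  finally have "(1 / \<rho>) \<cdot>\<^sub>v (?S *\<^sub>v x) = (1 / \<rho>) \<cdot>\<^sub>v (\<rho> \<cdot>\<^sub>v (A *\<^sub>v (?S *\<^sub>v x)))"
    by (rule arg_cong)
  then have "A *\<^sub>v (?S *\<^sub>v x) = (1 / \<rho>) \<cdot>\<^sub>v (?S *\<^sub>v x)"
    using \<rho> by (simp add: smult_smult_assoc)
  moreover have "?S *\<^sub>v x \<noteq> 0\<^sub>v n"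
  proof
    assume "?S *\<^sub>v x = 0\<^sub>v n"
    then have "(?S *\<^sub>v x) $ 0 = 0" using n by simp
    then show False using sign_mat_mult_vec[OF x n] xpos[OF n] by simp
  qed
  ultimately have "eigenvalue A (1 / \<rho>)"
    using A Sx unfolding eigenvalue_def eigenvector_def by (metis carrier_matD(1))
  moreover have "1 / \<rho> < t"
    if k: "k < n" and t: "t \<ge> 0" and ev: "eigenvalue (mat_delete A k k) t" for k t
  proof (rule ccontr)
    assume "\<not> 1 / \<rho> < t"
    then have t\<rho>: "t * \<rho> \<le> 1" using \<rho> by (simp add: field_simps)
    have D: "mat_delete A k k \<in> carrier_mat (n - 1) (n - 1)" using A by (auto simp: mat_delete_def)
    obtain v where v: "v \<in> carrier_vec (n - 1)" "v \<noteq> 0\<^sub>v (n - 1)" "mat_delete A k k *\<^sub>v v = t \<cdot>\<^sub>v v"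
      using ev D unfolding eigenvalue_def eigenvector_def by auto
    obtain z c where z: "z \<in> carrier_vec n" "z $ k = 0"
      and z_ins: "\<And>i. i < n - 1 \<Longrightarrow> z $ insert_index k i = v $ i"
      and Az: "A *\<^sub>v z = t \<cdot>\<^sub>v z + c \<cdot>\<^sub>v unit_vec n k"
      using eigenvector_mat_delete_extend[OF A k v(1,3)] by metis
    define w where "w = ?S *\<^sub>v z"
    have w: "w \<in> carrier_vec n" unfolding w_def using sign_mat_carrier z(1) by (rule mult_mat_vec_carrier)
    have wk: "w $ k = 0" using z k by (simp add: w_def sign_mat_mult_vec del: index_mult_mat_vec)
    \<comment> \<open>\<open>S\<close> only changes the sign of the defect \<open>c\<close>. That
      sign is unknown, so both signs must be covered by the exclusion of nonzero solutions.\<close>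
    have Se: "?S *\<^sub>v unit_vec n k = (-1) ^ k \<cdot>\<^sub>v unit_vec n k"
    proof (rule eq_vecI)
      fix i assume "i < dim_vec ((-1) ^ k \<cdot>\<^sub>v unit_vec n k :: real vec)"
      then have "i < n" by simp
      then show "(?S *\<^sub>v unit_vec n k) $ i = ((-1) ^ k \<cdot>\<^sub>v unit_vec n k) $ i"
        using k by (auto simp: sign_mat_mult_vec simp del: index_mult_mat_vec)
    qed (simp add: carrier_matD[OF sign_mat_carrier])
    have SA: "?S * A \<in> carrier_mat n n" using sign_mat_carrier A by (rule mult_carrier_mat)
    have e: "unit_vec n k \<in> carrier_vec n" by simp
    have "w = (?B * (?S * A)) *\<^sub>v z"
      unfolding w_def signed_inverse_mult_sign_mat[OF A less_imp_neq[OF d, symmetric]] ..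
    also have "\<dots> = ?B *\<^sub>v ((?S * A) *\<^sub>v z)"
      by (rule assoc_mult_mat_vec[OF B SA z(1)])
    also have "(?S * A) *\<^sub>v z = ?S *\<^sub>v (A *\<^sub>v z)"
      by (rule assoc_mult_mat_vec[OF sign_mat_carrier A z(1)])
    also have "?S *\<^sub>v (A *\<^sub>v z) = t \<cdot>\<^sub>v w + (c * (-1) ^ k) \<cdot>\<^sub>v unit_vec n k"
      unfolding Az w_def using z(1) e
      by (simp add: mult_add_distrib_mat_vec[OF sign_mat_carrier] mult_mat_vec[OF sign_mat_carrier]
          Se smult_smult_assoc)
    also have "?B *\<^sub>v \<dots> = t \<cdot>\<^sub>v (?B *\<^sub>v w) + (c * (-1) ^ k) \<cdot>\<^sub>v (?B *\<^sub>v unit_vec n k)"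
      using w e by (simp add: mult_add_distrib_mat_vec[OF B] mult_mat_vec[OF B])
    finally have eq: "w = t \<cdot>\<^sub>v (?B *\<^sub>v w) + (c * (-1) ^ k) \<cdot>\<^sub>v (?B *\<^sub>v unit_vec n k)" .
    have "w = 0\<^sub>v n"
    proof (rule no_subcritical_bordered_solution[OF B pos x xpos eig t t\<rho> w k wk])
      fix i assume i: "i < n"
      have "(?B *\<^sub>v unit_vec n k) $ i = ?B $$ (i,k)"
        using i k B by simp
      then show "w $ i = t * (?B *\<^sub>v w) $ i + (c * (-1) ^ k) * ?B $$ (i,k)"
        using arg_cong[OF eq, of "\<lambda>v. v $ i"] i B
        by (simp del: index_mult_mat_vec)
    qed
    \<comment> \<open>Up to sign, the entries of \<open>w\<close> away from \<open>k\<close> are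
      those of \<open>v\<close>.\<close>
    have "v = 0\<^sub>v (n - 1)"
    proof (rule eq_vecI)
      fix i assume "i < dim_vec (0\<^sub>v (n - 1))"
      then have i: "i < n - 1" by simp
      then have less: "insert_index k i < n" by (auto simp: insert_index_def)
      then have "w $ insert_index k i = 0" using \<open>w = 0\<^sub>v n\<close> by simp
      then show "v $ i = 0\<^sub>v (n - 1) $ i"
        using sign_mat_mult_vec[OF z(1) less] z_ins[OF i] i by (simp add: w_def)
    qed (use v in simp)
    then show False using v by simp
  qed
  ultimately show thesis using that by blast
qed


section \<open>Least real eigenvalues of principal submatrices of SK-matrices\<close>

text \<open>A real number is an eigenvalue over the reals iff over the complex numbers, both meaning
  a root of the same characteristic polynomial. The given \<open>t\<close> excludes the infinite
  value.\<close>

lemma min_real_eigenvalue_of_real: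
  assumes A: "A \<in> carrier_mat n n" and ev: "eigenvalue A t"
  shows "min_real_eigenvalue (map_mat complex_of_real A) = ereal (Min {t. eigenvalue A t})"
proof -
  have cA: "map_mat complex_of_real A \<in> carrier_mat n n" using A by auto
  have "eigenvalue (map_mat complex_of_real A) (complex_of_real t) \<longleftrightarrow> eigenvalue A t" for t
    unfolding eigenvalue_root_char_poly[OF A] eigenvalue_root_char_poly[OF cA]
      of_real_hom.char_poly_hom[OF A]
    by simp
  then have "spectrum (map_mat complex_of_real A) \<inter> \<real> = complex_of_real ` {t. eigenvalue A t}"
    unfolding spectrum_def by (auto elim!: Reals_cases)
  then show ?thesis
    using ev unfolding min_real_eigenvalue_def by (auto simp: image_image)
qed

context
  fixes A :: "real mat" and n :: nat
  assumes A: "A \<in> carrier_mat n n" and SK: "SK_matrix A"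
begin

lemma SK_principal_minor_pos:
  assumes "\<alpha> \<noteq> {}" "\<alpha> \<subseteq> {..<n}"
  shows "det (submatrix A \<alpha> \<alpha>) > 0"
  using SK A assms unfolding SK_matrix_def principal_minors_pos_def by auto

text \<open>Deleting equal positions leaves a principal minor, deleting different ones an almost
  principal minor.\<close>

lemma SK_minor_mat_delete_pos:
  assumes \<alpha>: "\<alpha> \<subseteq> {..<n}" and i: "i < card \<alpha>" and j: "j < card \<alpha>"
  shows "det (mat_delete (submatrix A \<alpha> \<alpha>) i j) > 0"
proof (cases "i = j")
  case True
  have eq: "mat_delete (submatrix A \<alpha> \<alpha>) i j = submatrix A (\<alpha> - {pick \<alpha> i}) (\<alpha> - {pick \<alpha> i})"
    using mat_delete_submatrix[OF A \<alpha> \<alpha> i j] True by simp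
  show ?thesis
  proof (cases "\<alpha> - {pick \<alpha> i} = {}")
    case empty: True
    \<comment> \<open>For a singleton \<open>\<alpha>\<close> the deleted matrix is 0 by 0, with
      determinant 1.\<close>
    have "submatrix A {} {} \<in> carrier_mat 0 0" using submatrix_carrier[OF A, of "{}" "{}"] by simp
    then show ?thesis
      unfolding eq empty by simp
  next
    case False
    then show ?thesis
      unfolding eq using \<alpha> by (intro SK_principal_minor_pos) auto
  qed
next
  case False
  then have "pick \<alpha> i \<noteq> pick \<alpha> j" using i j by (metis nat_neq_iff pick_mono_le)
  then show ?thesis
    using SK A \<alpha> i j pick_in_set_le[of i \<alpha>] pick_in_set_le[of j \<alpha>]
    unfolding mat_delete_submatrix[OF A \<alpha> \<alpha> i j] SK_matrix_def almost_principal_minors_pos_def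
    by auto
qed

text \<open>The comparison restated for index sets; the premise \<open>t \<ge> 0\<close> disappears
  because real eigenvalues of principal submatrices are positive.\<close>

lemma SK_eigenvalue_less:
  assumes \<alpha>: "\<alpha> \<noteq> {}" "\<alpha> \<subseteq> {..<n}"
  obtains l where "eigenvalue (submatrix A \<alpha> \<alpha>) l"
    "\<And>k t. k \<in> \<alpha> \<Longrightarrow> eigenvalue (submatrix A (\<alpha> - {k}) (\<alpha> - {k})) t \<Longrightarrow> l < t"
proof -
  have fin: "finite \<alpha>" using \<alpha>(2) finite_subset by blast
  then have card: "card \<alpha> > 0" using \<alpha>(1) by (simp add: card_gt_0_iff)
  obtain l where l: "eigenvalue (submatrix A \<alpha> \<alpha>) l"
    and less: "\<And>k t. k < card \<alpha> \<Longrightarrow> t \<ge> 0 \<Longrightarrow> eigenvalue (mat_delete (submatrix A \<alpha> \<alpha>) k k) t \<Longrightarrow> l < t"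
    using eigenvalue_less_of_mat_delete[OF submatrix_carrier[OF A \<alpha>(2) \<alpha>(2)]
        SK_principal_minor_pos[OF \<alpha>] SK_minor_mat_delete_pos[OF \<alpha>(2)] card] by metis
  have "l < t" if k: "k \<in> \<alpha>" and ev: "eigenvalue (submatrix A (\<alpha> - {k}) (\<alpha> - {k})) t" for k t
  proof -
    \<comment> \<open>The position of \<open>k\<close> in the increasing enumeration of
      \<open>\<alpha>\<close>.\<close>
    define i where "i = card {a \<in> \<alpha>. a < k}"
    have i: "i < card \<alpha>" unfolding i_def using k fin by (intro psubset_card_mono) auto
    have "pick \<alpha> i = k" unfolding i_def using k by (rule pick_card_in_set)
    then have "eigenvalue (mat_delete (submatrix A \<alpha> \<alpha>) i i) t"
      using ev mat_delete_submatrix[OF A \<alpha>(2) \<alpha>(2) i i] by simp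
    moreover have "t > 0"
      using eigenvalue_submatrix_pos[OF A SK_principal_minor_pos _ ev] \<alpha>(2) by auto
    ultimately show ?thesis using less[OF i] by simp
  qed
  then show thesis using that l by blast
qed

text \<open>A real-valued version of \<open>l\<close>, so that comparisons avoid extended reals. For
  nonempty \<open>\<alpha>\<close> within range the set is finite and nonempty, hence
  \<open>Min\<close> is a true minimum.\<close>

definition least_real_eigenvalue :: "nat set \<Rightarrow> real" where
  "least_real_eigenvalue \<alpha> = Min {t. eigenvalue (submatrix A \<alpha> \<alpha>) t}"

lemma finite_real_eigenvalues:
  assumes "\<alpha> \<subseteq> {..<n}"
  shows "finite {t. eigenvalue (submatrix A \<alpha> \<alpha>) t}"
  using card_finite_spectrum(1)[OF submatrix_carrier[OF A assms assms]]
  unfolding spectrum_def .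

lemma eigenvalue_least_real_eigenvalue:
  assumes "\<alpha> \<noteq> {}" "\<alpha> \<subseteq> {..<n}"
  shows "eigenvalue (submatrix A \<alpha> \<alpha>) (least_real_eigenvalue \<alpha>)"
proof -
  obtain l where "eigenvalue (submatrix A \<alpha> \<alpha>) l" by (rule SK_eigenvalue_less[OF assms])
  then have "{t. eigenvalue (submatrix A \<alpha> \<alpha>) t} \<noteq> {}" by blast
  from Min_in[OF finite_real_eigenvalues[OF assms(2)] this] show ?thesis
    by (simp add: least_real_eigenvalue_def)
qed

lemma SK_min_real_eigenvalue:
  assumes "\<alpha> \<noteq> {}" "\<alpha> \<subseteq> {..<n}"
  shows "min_real_eigenvalue (principal_submatrix (map_mat complex_of_real A) \<alpha>)
    = ereal (least_real_eigenvalue \<alpha>)"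
  unfolding principal_submatrix_def map_mat_submatrix[OF A assms(2,2)] least_real_eigenvalue_def
  by (rule min_real_eigenvalue_of_real[OF submatrix_carrier[OF A assms(2,2)]
        eigenvalue_least_real_eigenvalue[OF assms]])

lemma least_real_eigenvalue_pos:
  assumes "\<alpha> \<noteq> {}" "\<alpha> \<subseteq> {..<n}"
  shows "least_real_eigenvalue \<alpha> > 0"
  using eigenvalue_submatrix_pos[OF A SK_principal_minor_pos assms(2)
      eigenvalue_least_real_eigenvalue[OF assms]] .

text \<open>The Perron eigenvalue \<open>l\<close> separates the two minima: it is at least the
  first and strictly below the second.\<close>

lemma least_real_eigenvalue_remove:
  assumes "\<alpha> \<subseteq> {..<n}" "k \<in> \<alpha>" "\<alpha> - {k} \<noteq> {}"
  shows "least_real_eigenvalue \<alpha> < least_real_eigenvalue (\<alpha> - {k})"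
proof -
  obtain l where l: "eigenvalue (submatrix A \<alpha> \<alpha>) l"
    and less: "\<And>k t. k \<in> \<alpha> \<Longrightarrow> eigenvalue (submatrix A (\<alpha> - {k}) (\<alpha> - {k})) t \<Longrightarrow> l < t"
    using SK_eigenvalue_less[OF _ assms(1)] assms(2) by (metis empty_iff)
  have "least_real_eigenvalue \<alpha> \<le> l"
    unfolding least_real_eigenvalue_def using finite_real_eigenvalues[OF assms(1)] l by simp
  also have "l < least_real_eigenvalue (\<alpha> - {k})"
    using assms by (intro less[OF assms(2)] eigenvalue_least_real_eigenvalue) auto
  finally show ?thesis .
qed

text \<open>The indices outside \<open>\<beta>\<close> are removed one at a time; each removal
  strictly raises the least eigenvalue.\<close>

lemma least_real_eigenvalue_strict_antimono:
  assumes "\<beta> \<noteq> {}" "\<beta> \<subset> \<alpha>" "\<alpha> \<subseteq> {..<n}"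
  shows "least_real_eigenvalue \<alpha> < least_real_eigenvalue \<beta>"
proof -
  have "finite \<alpha>" using assms(3) finite_subset by blast
  then show ?thesis using assms
  proof (induction \<alpha> rule: finite_psubset_induct)
    case (psubset \<alpha>)
    then obtain k where k: "k \<in> \<alpha>" "k \<notin> \<beta>" by blast
    then have \<beta>: "\<beta> \<subseteq> \<alpha> - {k}" using psubset.prems by blast
    then have "least_real_eigenvalue \<alpha> < least_real_eigenvalue (\<alpha> - {k})"
      using psubset.prems k by (intro least_real_eigenvalue_remove) auto
    also have "\<dots> \<le> least_real_eigenvalue \<beta>"
    proof (cases "\<beta> = \<alpha> - {k}")
      case False
      then show ?thesis
        using psubset.IH[of "\<alpha> - {k}"] psubset.prems k \<beta> by (intro less_imp_le) auto
    qed simp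
    finally show ?case .
  qed
qed

end

theorem theorem5:
  fixes A :: "real mat" and n :: nat
  assumes "n \<ge> 1"
    and "A \<in> carrier_mat n n"
    and "SK_matrix A"
  shows "strict_tau_matrix (map_mat complex_of_real A)"
proof -
  let ?C = "map_mat complex_of_real A"
  note A = assms(2) and facts = assms(2,3)
  have ne: "{..<n} \<noteq> {}" using assms(1) by (auto simp: lessThan_empty_iff)
  have C: "?C \<in> carrier_mat n n" using A by auto
  \<comment> \<open>The whole matrix is its own principal submatrix on the full index set.\<close>
  have "min_real_eigenvalue ?C = ereal (least_real_eigenvalue A {..<n})"
    using SK_min_real_eigenvalue[OF facts ne order_refl] submatrix_lessThan[OF C]
    by (simp add: principal_submatrix_def)
  then have pos: "min_real_eigenvalue ?C > 0"
    using least_real_eigenvalue_pos[OF facts ne order_refl] by simp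
  have less: "min_real_eigenvalue (principal_submatrix ?C \<alpha>) < min_real_eigenvalue (principal_submatrix ?C \<beta>)"
    if "\<beta> \<noteq> {}" "\<beta> \<subset> \<alpha>" "\<alpha> \<subseteq> {..<n}" for \<alpha> \<beta>
  proof -
    have "\<alpha> \<noteq> {}" "\<beta> \<subseteq> {..<n}" using that by auto
    then show ?thesis
      using that least_real_eigenvalue_strict_antimono[OF facts that]
      by (simp add: SK_min_real_eigenvalue[OF facts])
  qed
  have finite: "min_real_eigenvalue (principal_submatrix ?C \<beta>) < \<infinity>"
    if "\<beta> \<noteq> {}" "\<beta> \<subseteq> {..<n}" for \<beta>
    using that by (simp add: SK_min_real_eigenvalue[OF facts])
  have dim: "dim_row ?C = n" and sq: "square_mat ?C" using A by auto
  have "tau_matrix ?C"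
    unfolding tau_matrix_def dim
  proof (intro conjI allI impI; (elim conjE)?)
    fix \<alpha> \<beta> :: "nat set"
    assume *: "\<beta> \<noteq> {}" "\<beta> \<subseteq> \<alpha>" "\<alpha> \<subseteq> {..<n}"
    show "min_real_eigenvalue (principal_submatrix ?C \<alpha>) \<le> min_real_eigenvalue (principal_submatrix ?C \<beta>)"
      \<comment> \<open>Only \<open>\<beta> = \<alpha>\<close> is left uncovered by the strict
        inequality.\<close>
      using less[of \<beta> \<alpha>] * by (cases "\<beta> = \<alpha>") (simp, simp add: psubset_eq less_imp_le)
    show "min_real_eigenvalue (principal_submatrix ?C \<beta>) < \<infinity>"
      using finite * by auto
  qed (use sq pos in auto)
  then show ?thesis
    unfolding strict_tau_matrix_def dim using pos less by auto
qed

end
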